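(* Let $S,T,A,B$ be finite nonempty sets and $N=|S||A|+|T||B|$. For any convex cone $\mathcal K\subseteq\mathcal{DNN}^N$ we have $\mathrm{Corr}(\mathcal K)\subseteq\mathcal{NS}$.
   Context: $\mathcal{DNN}^N$ is the set of real symmetric positive semidefinite $N\times N$ matrices with all entries nonnegative. Real symmetric $N\times N$ matrices are indexed by the disjoint union of $S\times A$ and $T\times B$ (in $S\cup T$, $S$ and $T$ are regarded as disjoint). For $i,j\in S\cup T$, $\langle J_{i,j},X\rangle:=\sum_{k,l}X[(i,k),(j,l)]$ is the sum of entries in block $(i,j)$ ($k\in A$ if $i\in S$, $k\in B$ if $i\in T$; likewise $l$ and $j$). $\mathrm{Corr}(\mathcal K)$ is the set of vectors $p=(p(a,b|s,t))\in\mathbb R^{|A\times B\times S\times T|}$ for which there is $X\in\mathcal K$ with $\langle J_{i,j},X\rangle=1$ for all $i,j\in S\cup T$ and $X[(s,a),(t,b)]=p(a,b|s,t)$ for all $a,b,s,t$. $\mathcal{NS}$ is the set of vectors $p=(p(a,b|s,t))$ with $p(a,b|s,t)\ge0$, $\sum_{a,b}p(a,b|s,t)=1$ for all $s,t$, $\sum_b p(a,b|s,t)=\sum_b p(a,b|s,t')$ for all $a\in A$, $s\in S$, $t\neq t'\in T$, and $\sum_a p(a,b|s,t)=\sum_a p(a,b|s',t)$ for all $b\in B$, $t\in T$, $s\ne s'\in S$. *)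

theory Defs
  imports "HOL-Analysis.Analysis"
begin

text \<open>
  The finite nonempty sets \<open>S, T, A, B\<close> are the universes of types \<open>'s, 't, 'a, 'b\<close> of class
  \<open>finite\<close>. Rows and columns are indexed by \<open>('s \<times> 'a) + ('t \<times> 'b)\<close>, and the coordinates of a
  correlation vector by \<open>'a \<times> 'b \<times> 's \<times> 't\<close>: the real number \<open>p(a,b|s,t)\<close> is \<open>p $ (a, b, s, t)\<close>.
\<close>

definition symmetric_psd :: "real ^ 'n ^ 'n \<Rightarrow> bool" where
  "symmetric_psd X \<longleftrightarrow> transpose X = X \<and> (\<forall>v. 0 \<le> v \<bullet> (X *v v))"

definition DNN :: "(real ^ 'n ^ 'n) set" where
  "DNN = {X. symmetric_psd X \<and> (\<forall>i j. 0 \<le> X $ i $ j)}"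

primrec block :: "'s + 't \<Rightarrow> (('s \<times> 'a) + ('t \<times> 'b)) set" where
  "block (Inl s) = {Inl (s, a) | a. True}"
| "block (Inr t) = {Inr (t, b) | b. True}"

text \<open>\<open>block_sum i j X\<close> is the pairing of \<open>X\<close> with the 0/1 matrix \<open>J\<close> supported on block \<open>(i, j)\<close>.\<close>

definition block_sum ::
    "'s::finite + 't::finite \<Rightarrow> 's + 't \<Rightarrow>
     real ^ (('s \<times> 'a::finite) + ('t \<times> 'b::finite)) ^ (('s \<times> 'a) + ('t \<times> 'b)) \<Rightarrow> real" where
  "block_sum i j X = (\<Sum>r\<in>block i. \<Sum>c\<in>block j. X $ r $ c)"

definition Corr ::
    "(real ^ (('s::finite \<times> 'a::finite) + ('t::finite \<times> 'b::finite))
           ^ (('s \<times> 'a) + ('t \<times> 'b))) set \<Rightarrow> (real ^ ('a \<times> 'b \<times> 's \<times> 't)) set" where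
  "Corr K = {p. \<exists>X\<in>K. (\<forall>i j. block_sum i j X = 1) \<and>
                      (\<forall>a b s t. X $ Inl (s, a) $ Inr (t, b) = p $ (a, b, s, t))}"

definition NS :: "(real ^ ('a::finite \<times> 'b::finite \<times> 's::finite \<times> 't::finite)) set" where
  "NS = {p. (\<forall>a b s t. 0 \<le> p $ (a, b, s, t)) \<and>
            (\<forall>s t. (\<Sum>a\<in>UNIV. \<Sum>b\<in>UNIV. p $ (a, b, s, t)) = 1) \<and>
            (\<forall>a s t t'. t \<noteq> t' \<longrightarrow>
               (\<Sum>b\<in>UNIV. p $ (a, b, s, t)) = (\<Sum>b\<in>UNIV. p $ (a, b, s, t'))) \<and>
            (\<forall>b t s s'. s \<noteq> s' \<longrightarrow>
               (\<Sum>a\<in>UNIV. p $ (a, b, s, t)) = (\<Sum>a\<in>UNIV. p $ (a, b, s', t)))}"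

end

theory Submission
  imports Defs
begin

text \<open>
  If \<open>v\<close> and \<open>w\<close> are the indicator vectors of two blocks, the four block sums equal to \<open>1\<close> give
  \<open>(v - w) \<bullet> X (v - w) = 1 - 1 - 1 + 1 = 0\<close>. For a positive semidefinite \<open>X\<close> this forces
  \<open>X v = X w\<close>: within a row of \<open>X\<close>, all blocks have the same sum. In the off-diagonal blocks this
  is precisely the no-signalling condition.
\<close>

text \<open>Move from \<open>v\<close> in direction \<open>w = X *v v\<close>. The quadratic form
  there has no constant term, and its linear coefficient is twice the squared norm of
  \<open>w\<close>; unless \<open>w = 0\<close>, a small negative step would make it
  negative.\<close>

lemma symmetric_psd_kernel:
  fixes X :: "real ^ 'n ^ 'n"
  assumes "symmetric_psd X" and "v \<bullet> (X *v v) = 0"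
  shows "X *v v = 0"
proof -
  define w where "w = X *v v"
  define b where "b = w \<bullet> w"
  define c where "c = w \<bullet> (X *v w)"
  have psd: "0 \<le> u \<bullet> (X *v u)" for u
    using assms(1) by (simp add: symmetric_psd_def)
  have "transpose X = X"
    using assms(1) by (simp add: symmetric_psd_def)
  \<comment> \<open>By symmetry both cross terms of the expansion equal
    \<open>w \<bullet> w\<close>.\<close>
  then have "v v* X = w"
    unfolding w_def by (metis vector_transpose_matrix)
  then have "v \<bullet> (X *v w) = w \<bullet> w"
    by (simp flip: dot_lmul_matrix)
  then have quad: "(v + r *\<^sub>R w) \<bullet> (X *v (v + r *\<^sub>R w)) = 2 * r * b + r\<^sup>2 * c" for r
    using assms(2)
    by (simp add: matrix_vector_right_distrib matrix_vector_mult_scaleR inner_add_left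
        inner_add_right b_def c_def power2_eq_square distrib_left flip: w_def)
  have "c \<ge> 0"
    using psd by (simp add: c_def)
  \<comment> \<open>The minimizer would be \<open>r = - b / c\<close>; the denominator
    \<open>c + 1\<close> stays positive when \<open>c = 0\<close> and still gives a negative value
    if \<open>b \<noteq> 0\<close>.\<close>
  have "0 \<le> 2 * (- b / (c + 1)) * b + (- b / (c + 1))\<^sup>2 * c"
    unfolding quad[symmetric] by (rule psd)
  also have "\<dots> = - (b\<^sup>2 * (c + 2) / (c + 1)\<^sup>2)"
    using \<open>c \<ge> 0\<close> by (simp add: divide_simps power2_eq_square) (simp add: algebra_simps)
  finally have "b\<^sup>2 * (c + 2) / (c + 1)\<^sup>2 \<le> 0" by simp
  then have "b = 0"
    using \<open>c \<ge> 0\<close> by (auto simp: divide_le_0_iff mult_le_0_iff)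
  then show ?thesis
    by (simp add: b_def w_def)
qed

lemma block_Inl: "block (Inl s) = (\<lambda>a. Inl (s, a)) ` UNIV"
  by auto

lemma block_Inr: "block (Inr t) = (\<lambda>b. Inr (t, b)) ` UNIV"
  by auto

lemma sum_block_Inl: "sum f (block (Inl s)) = (\<Sum>a\<in>UNIV. f (Inl (s, a)))"
  unfolding block_Inl by (subst sum.reindex) (auto simp: inj_on_def)

lemma sum_block_Inr: "sum f (block (Inr t)) = (\<Sum>b\<in>UNIV. f (Inr (t, b)))"
  unfolding block_Inr by (subst sum.reindex) (auto simp: inj_on_def)

lemma matrix_vector_mult_indicator:
  fixes X :: "real ^ 'n ^ 'm"
  shows "(X *v (\<chi> c. indicator C c)) $ r = (\<Sum>c\<in>C. X $ r $ c)"
  by (simp add: matrix_vector_mult_def sum_indicator_mult)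

text \<open>This turns block sums into values of the bilinear form of \<open>X\<close>, where
  semidefiniteness can be applied.\<close>

lemma indicator_inner_matrix_vector_mult:
  fixes X :: "real ^ 'n ^ 'm"
  shows "(\<chi> r. indicator R r) \<bullet> (X *v (\<chi> c. indicator C c)) = (\<Sum>r\<in>R. \<Sum>c\<in>C. X $ r $ c)"
  unfolding inner_vec_def by (simp add: matrix_vector_mult_indicator sum_indicator_mult)

lemma row_block_sums_eq:
  fixes X :: "real ^ (('a::finite \<times> 'b::finite) + ('c::finite \<times> 'd::finite))
                   ^ (('a \<times> 'b) + ('c \<times> 'd))"
  assumes "symmetric_psd X" and "\<And>i j. block_sum i j X = 1"
  shows "(\<Sum>c\<in>block i. X $ r $ c) = (\<Sum>c\<in>block j. X $ r $ c)"
proof -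
  define e :: "'a + 'c \<Rightarrow> real ^ ('a \<times> 'b + 'c \<times> 'd)" where "e i = (\<chi> c. indicator (block i) c)" for i :: "'a + 'c"
  have "e i \<bullet> (X *v e j) = 1" for i j
    using assms(2) unfolding e_def indicator_inner_matrix_vector_mult block_sum_def .
  then have "(e i - e j) \<bullet> (X *v (e i - e j)) = 0"
    by (simp add: matrix_vector_mult_diff_distrib inner_diff_left inner_diff_right)
  then have "X *v (e i - e j) = 0"
    by (rule symmetric_psd_kernel[OF assms(1)])
  then have "(X *v e i) $ r = (X *v e j) $ r"
    by (simp add: matrix_vector_mult_diff_distrib)
  then show ?thesis
    by (simp add: e_def matrix_vector_mult_indicator)
qed

theorem theorem3p8:
  fixes K :: "(real ^ (('s::finite \<times> 'a::finite) + ('t::finite \<times> 'b::finite))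
                    ^ (('s \<times> 'a) + ('t \<times> 'b))) set"
  assumes "convex K" and "cone K" and "K \<subseteq> DNN"
  shows "Corr K \<subseteq> NS"
proof
  fix p
  assume "p \<in> Corr K"
  then obtain X where "X \<in> K" and one: "\<And>i j. block_sum i j X = 1"
    and p: "\<And>a b s t. X $ Inl (s, a) $ Inr (t, b) = p $ (a, b, s, t)"
    unfolding Corr_def by blast
  with assms(3) have psd: "symmetric_psd X" and nonneg: "\<And>i j. 0 \<le> X $ i $ j"
    unfolding DNN_def by auto
  \<comment> \<open>Sums over \<open>a\<close> run down columns of the block that carries
    \<open>p\<close>. Symmetry makes them row sums of the mirrored block.\<close>
  have p': "X $ Inr (t, b) $ Inl (s, a) = p $ (a, b, s, t)" for a b s t
  proof -
    have "transpose X $ Inl (s, a) $ Inr (t, b) = p $ (a, b, s, t)"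
      using psd p by (simp add: symmetric_psd_def)
    then show ?thesis
      by (simp add: transpose_def)
  qed
  note eq = row_block_sums_eq[OF psd one]
  have "(\<Sum>a\<in>UNIV. \<Sum>b\<in>UNIV. p $ (a, b, s, t)) = 1" for s t
    using one[of "Inl s" "Inr t"] by (simp only: block_sum_def sum_block_Inl sum_block_Inr p)
  \<comment> \<open>The marginal of \<open>a\<close> is the part of row \<open>(s, a)\<close> in
    column block \<open>t\<close>.\<close>
  moreover have "(\<Sum>b\<in>UNIV. p $ (a, b, s, t)) = (\<Sum>b\<in>UNIV. p $ (a, b, s, t'))" for a s t t'
    using eq[of "Inl (s, a)" "Inr t" "Inr t'"] by (simp only: sum_block_Inr p)
  moreover have "(\<Sum>a\<in>UNIV. p $ (a, b, s, t)) = (\<Sum>a\<in>UNIV. p $ (a, b, s', t))" for b t s s'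
    using eq[of "Inr (t, b)" "Inl s" "Inl s'"] by (simp only: sum_block_Inl p')
  moreover have "0 \<le> p $ (a, b, s, t)" for a b s t
    using nonneg p by metis
  ultimately show "p \<in> NS"
    unfolding NS_def by blast
qed

end
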